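(* Let $N$ be a positive integer and let $f_{rs}$ ($r,s\in\mathbb{Z}^+$, $1\le r,s\le N$) be an array of (finite) complex numbers. Then $$\sum_{r=1}^{N}\sum_{s=1}^{r}(f_{rs}+f_{sr})=\sum_{r=1}^N f_{rr}+\sum_{r=1}^{N}\sum_{s=1}^{N}f_{sr}.$$ *)

theory Defs
  imports Complex_Main
begin

end

theory Submission
  imports Defs
begin

text \<open>The lower triangle and its mirror image cover the square, with the diagonal counted
  twice. Induction on \<open>N\<close> makes this a matter of regrouping sums, so a commutative
  monoid suffices.\<close>

lemma sum_triangle_symmetrized:
  fixes f :: "nat \<Rightarrow> nat \<Rightarrow> 'a::comm_monoid_add"
  shows "(\<Sum>r=1..N. \<Sum>s=1..r. (f r s + f s r)) =
         (\<Sum>r=1..N. f r r) + (\<Sum>r=1..N. \<Sum>s=1..N. f s r)"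
proof (induction N)
  case 0
  then show ?case by simp
next
  case (Suc N)
  \<comment> \<open>Both sides gain row and column \<open>Suc N\<close>, with the corner
    \<open>f (Suc N) (Suc N)\<close> twice: on the right, once from the diagonal sum and once from
    the square. \<open>sum.distrib\<close> splits the new border off the old square.\<close>
  then show ?case by (simp add: sum.distrib ac_simps)
qed

theorem mainTheorem1:
  fixes N :: nat and f :: "nat \<Rightarrow> nat \<Rightarrow> complex"
  assumes "N > 0"
  shows "(\<Sum>r=1..N. \<Sum>s=1..r. (f r s + f s r)) =
         (\<Sum>r=1..N. f r r) + (\<Sum>r=1..N. \<Sum>s=1..N. f s r)"
  by (rule sum_triangle_symmetrized)

end
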